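(* For each positive integer $n$, let $K_n$ be the complete graph on the vertex set $[n]$. Then $$\mathrm{vol}(K_n)=2^{1-n}.$$ Hence the generating function is $$\sum_{n\ge1}\mathrm{vol}(K_n)x^n=\frac{2x}{2-x}.$$
   Context: $[n]=\{1,\dots,n\}$. For a finite simple graph $G=(VG,EG)$, the graph polytope is $P(G)=\{x\in[0,1]^{VG} : x_i+x_j\le 1 \text{ for every edge } ij\in EG\}$, and $\mathrm{vol}(G)$ denotes the $|VG|$-dimensional volume (Lebesgue measure) of $P(G)$. The generating function identity is an identity of power series in $x$. *)

theory Defs
  imports "HOL-Analysis.Analysis" "HOL-Computational_Algebra.Formal_Power_Series"
begin

(* A graph is a pair (vertex set, edge set); edges are unordered pairs, i.e. two-element
   sets of vertices, so simple graphs have neither loops nor multiple edges. *)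
type_synonym 'a graph = "'a set \<times> 'a set set"

definition finite_simple_graph :: "'a graph \<Rightarrow> bool" where
  "finite_simple_graph G \<longleftrightarrow>
     finite (fst G) \<and> snd G \<subseteq> {e. e \<subseteq> fst G \<and> card e = 2}"

(* Points of \<real>^V are the functions on V, represented as usual by functions that take the
   value undefined outside V; this is the underlying space of the product measure below. *)
definition graph_polytope :: "'a graph \<Rightarrow> ('a \<Rightarrow> real) set" where
  "graph_polytope G =
     {x \<in> fst G \<rightarrow>\<^sub>E {0..1}. \<forall>i j. {i, j} \<in> snd G \<longrightarrow> x i + x j \<le> 1}"

definition graph_vol :: "'a graph \<Rightarrow> real" where
  "graph_vol G = measure (\<Pi>\<^sub>M v\<in>fst G. lborel) (graph_polytope G)"

definition complete_graph :: "nat \<Rightarrow> nat graph" where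
  "complete_graph n = ({1..n}, {e. e \<subseteq> {1..n} \<and> card e = 2})"

lemma finite_simple_graph_complete_graph: "finite_simple_graph (complete_graph n)"
  by (simp add: finite_simple_graph_def complete_graph_def)

(* The value of measure is meaningful: the polytope is a Borel set of finite measure. *)
lemma graph_polytope_sets:
  assumes "finite_simple_graph G"
  shows "graph_polytope G \<in> sets (\<Pi>\<^sub>M v\<in>fst G. lborel)"
proof -
  let ?V = "fst G" and ?M = "\<Pi>\<^sub>M v\<in>fst G. (lborel :: real measure)"
  let ?Q = "{(i, j) \<in> ?V \<times> ?V. {i, j} \<in> snd G}"
  have fin: "finite ?V" and sub: "\<And>i j. {i, j} \<in> snd G \<Longrightarrow> i \<in> ?V \<and> j \<in> ?V"
    using assms by (auto simp: finite_simple_graph_def)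
  have finQ: "finite ?Q"
    by (rule finite_subset[of _ "?V \<times> ?V"]) (use fin in auto)
  have eq: "graph_polytope G =
      (?V \<rightarrow>\<^sub>E {0..1}) \<inter> {x \<in> space ?M. \<forall>p\<in>?Q. x (fst p) + x (snd p) \<le> 1}"
  proof (intro equalityI subsetI)
    fix x assume "x \<in> graph_polytope G"
    then show "x \<in> (?V \<rightarrow>\<^sub>E {0..1}) \<inter> {x \<in> space ?M. \<forall>p\<in>?Q. x (fst p) + x (snd p) \<le> 1}"
      by (auto simp: graph_polytope_def space_PiM PiE_def)
  next
    fix x assume x: "x \<in> (?V \<rightarrow>\<^sub>E {0..1}) \<inter> {x \<in> space ?M. \<forall>p\<in>?Q. x (fst p) + x (snd p) \<le> 1}"
    have "x i + x j \<le> 1" if "{i, j} \<in> snd G" for i j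
    proof -
      have "(i, j) \<in> ?Q"
        using that sub[OF that] by simp
      then show ?thesis using x by fastforce
    qed
    then show "x \<in> graph_polytope G"
      using x by (simp add: graph_polytope_def)
  qed
  have "(?V \<rightarrow>\<^sub>E {0..1}) \<in> sets ?M"
    using fin by (intro sets_PiM_I_finite) auto
  moreover have "{x \<in> space ?M. \<forall>p\<in>?Q. x (fst p) + x (snd p) \<le> 1} \<in> sets ?M"
  proof (rule sets.sets_Collect_finite_All[OF _ finQ])
    fix p assume "p \<in> ?Q"
    then have "fst p \<in> ?V" "snd p \<in> ?V" by auto
    have comp: "(\<lambda>x. x i) \<in> borel_measurable ?M" if "i \<in> ?V" for i
      using measurable_component_singleton[OF that, of "\<lambda>_. lborel :: real measure"]
      by (simp only: measurable_lborel1)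
    note comp[OF \<open>fst p \<in> ?V\<close>, measurable] comp[OF \<open>snd p \<in> ?V\<close>, measurable]
    show "{x \<in> space ?M. x (fst p) + x (snd p) \<le> 1} \<in> sets ?M"
      by measurable
  qed
  ultimately show ?thesis unfolding eq by (rule sets.Int)
qed

lemma graph_polytope_emeasure_le_1:
  assumes "finite_simple_graph G"
  shows "emeasure (\<Pi>\<^sub>M v\<in>fst G. lborel) (graph_polytope G) \<le> 1"
proof -
  interpret product_sigma_finite "\<lambda>_ :: 'a. lborel :: real measure"
    by unfold_locales
  have fin: "finite (fst G)"
    using assms by (simp add: finite_simple_graph_def)
  have "emeasure (\<Pi>\<^sub>M v\<in>fst G. lborel) (graph_polytope G)
      \<le> emeasure (\<Pi>\<^sub>M v\<in>fst G. lborel) (fst G \<rightarrow>\<^sub>E {0..1::real})"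
    using fin by (intro emeasure_mono sets_PiM_I_finite) (auto simp: graph_polytope_def)
  also have "\<dots> = 1"
    using fin by (subst emeasure_PiM) auto
  finally show ?thesis .
qed

end

theory Submission
  imports Defs
begin

text \<open>
  Two coordinates of a point of \<open>P(K\<^sub>n)\<close> cannot both exceed \<open>1/2\<close>. So the polytope is the disjoint
  union of the cube \<open>[0,1/2]\<^sup>n\<close>, of volume \<open>2\<^sup>-\<^sup>n\<close>, and of the \<open>n\<close> pieces on which one fixed coordinate
  \<open>t\<close> exceeds \<open>1/2\<close> and the others are at most \<open>1 - t\<close>. Each piece has volume
  \<open>\<integral> (1 - t)\<^sup>n\<^sup>-\<^sup>1 dt = 2\<^sup>-\<^sup>n / n\<close>, the integral being over \<open>[1/2,1]\<close>, which gives \<open>2 \<cdot> 2\<^sup>-\<^sup>n\<close> in total.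
\<close>

text \<open>The strict bound keeps each piece disjoint from the closed cube. Edges avoiding
  \<open>k\<close> are satisfied automatically: both ends are at most \<open>1 - x k\<close>, which
  is below 1/2.\<close>

definition dominant_piece :: "'a set \<Rightarrow> 'a \<Rightarrow> ('a \<Rightarrow> real) set" where
  "dominant_piece V k =
     {x \<in> V \<rightarrow>\<^sub>E {0..1}. 1/2 < x k \<and> (\<forall>j\<in>V - {k}. x j \<le> 1 - x k)}"

lemma sets_dominant_piece:
  assumes "finite V" "k \<in> V"
  shows "dominant_piece V k \<in> sets (\<Pi>\<^sub>M v\<in>V. lborel)"
proof -
  let ?M = "\<Pi>\<^sub>M v\<in>V. (lborel :: real measure)"
  have comp: "(\<lambda>x. x i) \<in> borel_measurable ?M" if "i \<in> V" for i
    using measurable_component_singleton[OF that, of "\<lambda>_. lborel :: real measure"]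
    by (simp only: measurable_lborel1)
  note comp[OF assms(2), measurable]
  have eq: "dominant_piece V k = (V \<rightarrow>\<^sub>E {0..1}) \<inter> ({x \<in> space ?M. 1/2 < x k} \<inter>
      {x \<in> space ?M. \<forall>j\<in>V - {k}. x j \<le> 1 - x k})"
    by (auto simp: dominant_piece_def space_PiM PiE_def)
  have "{x \<in> space ?M. \<forall>j\<in>V - {k}. x j \<le> 1 - x k} \<in> sets ?M"
  proof (rule sets.sets_Collect_finite_All)
    fix j assume "j \<in> V - {k}"
    then have "j \<in> V" by simp
    note comp[OF this, measurable]
    show "{x \<in> space ?M. x j \<le> 1 - x k} \<in> sets ?M"
      by measurable
  qed (use assms in auto)
  moreover have "{x \<in> space ?M. 1/2 < x k} \<in> sets ?M"
    by measurable
  moreover have "(V \<rightarrow>\<^sub>E {0..1}) \<in> sets ?M"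
    using assms by (intro sets_PiM_I_finite) auto
  ultimately show ?thesis
    unfolding eq by blast
qed

lemma emeasure_PiM_cube:
  assumes "finite V" "0 \<le> c"
  shows "emeasure (\<Pi>\<^sub>M v\<in>V. lborel) (V \<rightarrow>\<^sub>E {0..c}) = ennreal (c ^ card V)"
proof -
  interpret product_sigma_finite "\<lambda>_ :: 'a. lborel :: real measure"
    by unfold_locales
  have "emeasure (\<Pi>\<^sub>M v\<in>V. lborel) (V \<rightarrow>\<^sub>E {0..c}) = (\<Prod>v\<in>V. ennreal c)"
    using assms by (subst emeasure_PiM) auto
  then show ?thesis
    using assms by (simp add: ennreal_power)
qed

lemma nn_integral_upper_half_power:
  "(\<integral>\<^sup>+t. ennreal ((1 - t) ^ m) * indicator {1/2..1::real} t \<partial>lborel) =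
     ennreal ((1/2) ^ Suc m / real (Suc m))"
proof -
  \<comment> \<open>An antiderivative of the integrand. It vanishes at 1, so only the endpoint 1/2
    contributes.\<close>
  let ?F = "\<lambda>t::real. - ((1 - t) ^ Suc m / real (Suc m))"
  have "(\<integral>\<^sup>+t. ennreal ((1 - t) ^ m) * indicator {1/2..1::real} t \<partial>lborel) =
      ennreal (?F 1 - ?F (1/2))"
  proof (rule nn_integral_FTC_Icc)
    fix t :: real
    show "(?F has_real_derivative (1 - t) ^ m) (at t)"
      by (auto intro!: derivative_eq_intros simp del: power_Suc of_nat_Suc)
  qed auto
  then show ?thesis by simp
qed

text \<open>Tonelli with coordinate \<open>k\<close> outermost: once its value \<open>t\<close> is
  fixed above 1/2, the other coordinates range freely over a cube of side \<open>1 - t\<close>, and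
  a one-variable integral remains.\<close>

lemma emeasure_dominant_piece:
  assumes "finite V" "k \<in> V"
  shows "emeasure (\<Pi>\<^sub>M v\<in>V. lborel) (dominant_piece V k) = ennreal ((1/2) ^ card V / real (card V))"
proof -
  interpret product_sigma_finite "\<lambda>_ :: 'a. lborel :: real measure"
    by unfold_locales
  define I where "I = V - {k}"
  have I: "finite I" "k \<notin> I" and V: "V = insert k I" and card: "card V = Suc (card I)"
    using assms card.remove[OF assms] by (auto simp: I_def)
  let ?MI = "\<Pi>\<^sub>M v\<in>I. (lborel :: real measure)"
  \<comment> \<open>The piece asks for \<open>1/2 < t\<close>, while the integral formula uses the
    closed interval. They differ only at \<open>t = 1/2\<close>, a null set that the
    almost-everywhere congruence below discards.\<close>
  have slice: "(\<integral>\<^sup>+x. indicator (dominant_piece V k) (x(k := t)) \<partial>?MI) =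
      ennreal ((1 - t) ^ card I) * indicator {1/2..1} t" if "t \<noteq> 1/2" for t
  proof -
    have "(\<integral>\<^sup>+x. indicator (dominant_piece V k) (x(k := t)) \<partial>?MI) =
        (\<integral>\<^sup>+x. indicator {1/2..1} t * indicator (I \<rightarrow>\<^sub>E {0..1 - t}) x \<partial>?MI)"
    proof (rule nn_integral_cong)
      fix x assume "x \<in> space ?MI"
      then have ext: "x \<in> extensional I"
        by (auto simp: space_PiM PiE_def)
      have "x(k := t) \<in> dominant_piece V k \<longleftrightarrow> t \<in> {1/2..1} \<and> x \<in> I \<rightarrow>\<^sub>E {0..1 - t}"
      proof -
        have upd: "x(k := t) \<in> V \<rightarrow>\<^sub>E {0..1} \<longleftrightarrow> t \<in> {0..1} \<and> (\<forall>j\<in>I. x j \<in> {0..1})"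
          using ext I by (auto simp: V PiE_def extensional_def Pi_def)
        have dom: "(\<forall>j\<in>V - {k}. (x(k := t)) j \<le> 1 - (x(k := t)) k) \<longleftrightarrow> (\<forall>j\<in>I. x j \<le> 1 - t)"
          by (auto simp: I_def)
        have "x \<in> I \<rightarrow>\<^sub>E {0..1 - t} \<longleftrightarrow> (\<forall>j\<in>I. 0 \<le> x j \<and> x j \<le> 1 - t)"
          using ext by (auto simp: PiE_iff)
        \<comment> \<open>For \<open>t\<close> in the interval, \<open>1 - t\<close> is at most 1,
          so the bound by \<open>1 - t\<close> absorbs the unit cube's bound.\<close>
        then show ?thesis
          unfolding dominant_piece_def mem_Collect_eq upd dom
          using \<open>t \<noteq> 1/2\<close> by fastforce
      qed
      then show "indicator (dominant_piece V k) (x(k := t)) =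
          (indicator {1/2..1} t * indicator (I \<rightarrow>\<^sub>E {0..1 - t}) x :: ennreal)"
        by (auto simp: indicator_def)
    qed
    also have "\<dots> = indicator {1/2..1} t * emeasure ?MI (I \<rightarrow>\<^sub>E {0..1 - t})"
      using I by (intro nn_integral_cmult_indicator sets_PiM_I_finite) auto
    also have "\<dots> = ennreal ((1 - t) ^ card I) * indicator {1/2..1} t"
    \<comment> \<open>Inside the interval the side \<open>1 - t\<close> is nonnegative, as the cube
      formula requires; outside, both sides vanish.\<close>
    proof (cases "t \<in> {1/2..1}")
      case True
      then have "emeasure ?MI (I \<rightarrow>\<^sub>E {0..1 - t}) = ennreal ((1 - t) ^ card I)"
        using I by (intro emeasure_PiM_cube) auto
      then show ?thesis using True by simp
    qed simp
    finally show ?thesis .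
  qed
  have "emeasure (\<Pi>\<^sub>M v\<in>V. lborel) (dominant_piece V k) =
      (\<integral>\<^sup>+x. indicator (dominant_piece V k) x \<partial>(\<Pi>\<^sub>M v\<in>V. lborel))"
    using sets_dominant_piece[OF assms] by simp
  also have "\<dots> = (\<integral>\<^sup>+t. \<integral>\<^sup>+x. indicator (dominant_piece V k) (x(k := t)) \<partial>?MI \<partial>lborel)"
    using sets_dominant_piece[OF assms] I unfolding V
    by (intro product_nn_integral_insert_rev) auto
  also have "\<dots> = (\<integral>\<^sup>+t. ennreal ((1 - t) ^ card I) * indicator {1/2..1} t \<partial>lborel)"
    using AE_lborel_singleton[of "1/2 :: real"]
    by (intro nn_integral_cong_AE) (auto simp: slice)
  finally show ?thesis
    by (simp add: nn_integral_upper_half_power card)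
qed

lemma complete_graph_polytope_eq:
  "graph_polytope (V, {e. e \<subseteq> V \<and> card e = 2}) =
     (V \<rightarrow>\<^sub>E {0..1/2}) \<union> (\<Union>k\<in>V. dominant_piece V k)" (is "?P = ?C \<union> ?D")
proof -
  \<comment> \<open>Cardinality 2 excludes \<open>i = j\<close>; a constraint
    \<open>x i + x i \<le> 1\<close> would cut the polytope down to the small cube.\<close>
  have edge: "{i, j} \<subseteq> V \<and> card {i, j} = 2 \<longleftrightarrow> i \<in> V \<and> j \<in> V \<and> i \<noteq> j" for i j
    by (cases "i = j") auto
  have mem: "x \<in> ?P \<longleftrightarrow> x \<in> V \<rightarrow>\<^sub>E {0..1} \<and> (\<forall>i\<in>V. \<forall>j\<in>V. i \<noteq> j \<longrightarrow> x i + x j \<le> 1)" for x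
    unfolding graph_polytope_def fst_conv snd_conv mem_Collect_eq edge by blast
  show ?thesis
  proof (intro equalityI subsetI)
    fix x assume "x \<in> ?P"
    then have x: "x \<in> V \<rightarrow>\<^sub>E {0..1}" "\<And>i j. i \<in> V \<Longrightarrow> j \<in> V \<Longrightarrow> i \<noteq> j \<Longrightarrow> x i + x j \<le> 1"
      using mem by auto
    show "x \<in> ?C \<union> ?D"
    proof (cases "\<exists>k\<in>V. 1/2 < x k")
      case True
      then obtain k where k: "k \<in> V" "1/2 < x k" by blast
      have "x j \<le> 1 - x k" if "j \<in> V - {k}" for j
        using x(2)[of j k] that k by auto
      then show ?thesis
        using x(1) k by (auto simp: dominant_piece_def)
    next
      case False
      then show ?thesis
        using x(1) by (force simp: PiE_iff)
    qed
  next
    fix x assume "x \<in> ?C \<union> ?D"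
    then show "x \<in> ?P"
    proof
      assume C: "x \<in> ?C"
      then have half: "0 \<le> x i \<and> x i \<le> 1/2" if "i \<in> V" for i
        using that by (auto simp: PiE_iff)
      then have "x i \<in> {0..1}" if "i \<in> V" for i
        using that by force
      moreover have "x i + x j \<le> 1" if "i \<in> V" "j \<in> V" for i j
        using half[OF that(1)] half[OF that(2)] by linarith
      ultimately show ?thesis
        unfolding mem using C by (auto simp: PiE_iff)
    next
      assume "x \<in> ?D"
      then obtain k where k: "k \<in> V" "x \<in> V \<rightarrow>\<^sub>E {0..1}" "1/2 < x k"
        and le: "\<And>j. j \<in> V \<Longrightarrow> j \<noteq> k \<Longrightarrow> x j \<le> 1 - x k"
        by (auto simp: dominant_piece_def)
      \<comment> \<open>If \<open>k\<close> is one of the two, this is \<open>le\<close>. Otherwise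
        both values are at most \<open>1 - x k\<close>, hence below 1/2.\<close>
      have "x i + x j \<le> 1" if "i \<in> V" "j \<in> V" "i \<noteq> j" for i j
        using le[of i] le[of j] that k(3) by (cases "i = k"; cases "j = k") auto
      then show ?thesis
        unfolding mem using k(2) by blast
    qed
  qed
qed

text \<open>The pieces together weigh as much as the cube, hence the factor 2. Nonemptiness matters:
  for empty \<open>V\<close> there are no pieces and the volume is 1, not 2.\<close>

lemma graph_vol_complete:
  assumes "finite V" "V \<noteq> {}"
  shows "graph_vol (V, {e. e \<subseteq> V \<and> card e = 2}) = 2 * (1/2) ^ card V"
proof -
  let ?M = "\<Pi>\<^sub>M v\<in>V. (lborel :: real measure)"
  let ?C = "V \<rightarrow>\<^sub>E {0..1/2::real}" and ?D = "\<Union>k\<in>V. dominant_piece V k"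
  have setsC: "?C \<in> sets ?M"
    using assms by (intro sets_PiM_I_finite) auto
  have setsD: "dominant_piece V ` V \<subseteq> sets ?M"
    using sets_dominant_piece[OF assms(1)] by auto
  have card: "card V > 0"
    using assms by (simp add: card_gt_0_iff)
  have C: "emeasure ?M ?C = ennreal ((1/2) ^ card V)"
    using assms by (intro emeasure_PiM_cube) auto
  \<comment> \<open>A point in the pieces of distinct \<open>j\<close> and \<open>k\<close> would
    satisfy \<open>1/2 < x j \<le> 1 - x k < 1/2\<close>.\<close>
  have "disjoint_family_on (dominant_piece V) V"
    by (force simp: disjoint_family_on_def dominant_piece_def)
  then have "emeasure ?M ?D = (\<Sum>k\<in>V. emeasure ?M (dominant_piece V k))"
    using setsD assms by (intro sum_emeasure[symmetric])
  also have "\<dots> = (\<Sum>k\<in>V. ennreal ((1/2) ^ card V / real (card V)))"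
    using assms by (intro sum.cong emeasure_dominant_piece) auto
  also have "\<dots> = ennreal ((1/2) ^ card V)"
    using card by (simp add: ennreal_of_nat_eq_real_of_nat flip: ennreal_mult)
  finally have D: "emeasure ?M ?D = ennreal ((1/2) ^ card V)" .
  have "?C \<inter> ?D = {}"
    by (force simp: dominant_piece_def PiE_iff)
  then have "emeasure ?M (?C \<union> ?D) = emeasure ?M ?C + emeasure ?M ?D"
    using setsC setsD assms by (intro plus_emeasure[symmetric]) auto
  also have "\<dots> = ennreal (2 * (1/2) ^ card V)"
    unfolding C D by (simp flip: ennreal_plus)
  finally have "emeasure ?M (?C \<union> ?D) = ennreal (2 * (1/2) ^ card V)" .
  then have "measure ?M (?C \<union> ?D) = 2 * (1/2) ^ card V"
    by (intro measure_eq_emeasure_eq_ennreal) auto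
  then show ?thesis
    by (simp add: graph_vol_def complete_graph_polytope_eq)
qed

theorem corollary2p6:
  "(\<forall>n::nat. n \<ge> 1 \<longrightarrow> graph_vol (complete_graph n) = 2 powi (1 - int n)) \<and>
   Abs_fps (\<lambda>n. if n \<ge> 1 then graph_vol (complete_graph n) else 0) =
     (2 * fps_X / (2 - fps_X) :: real fps)"
proof
  have vol: "graph_vol (complete_graph n) = 2 * (1/2) ^ n" if "n \<ge> 1" for n
    using graph_vol_complete[of "{1..n}"] that by (simp add: complete_graph_def)
  show "\<forall>n::nat. n \<ge> 1 \<longrightarrow> graph_vol (complete_graph n) = 2 powi (1 - int n)"
    by (auto simp: vol power_int_diff power_one_over)
  let ?F = "Abs_fps (\<lambda>n. if n \<ge> 1 then graph_vol (complete_graph n) else 0)"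
  \<comment> \<open>With \<open>a n\<close> the coefficients of \<open>?F\<close>, the product has
    coefficients \<open>2 * a n - a (n - 1)\<close> for positive \<open>n\<close>. These vanish from
    \<open>n = 2\<close> on, because \<open>a n\<close> halves at each step.\<close>
  have "?F * (2 - fps_X) = 2 * fps_X"
  proof (rule fps_ext)
    fix n
    show "fps_nth (?F * (2 - fps_X)) n = fps_nth (2 * fps_X) n"
    proof (cases n)
      case (Suc m)
      \<comment> \<open>The case \<open>n = 1\<close> is separate: its predecessor is the 0 set by
        the \<open>if\<close>, not a volume, so the coefficient is
        \<open>2 * a 1 = 2\<close>.\<close>
      then show ?thesis
        by (cases m) (simp_all add: vol algebra_simps numeral_fps_const)
    qed (simp add: algebra_simps numeral_fps_const)
  qed
  moreover have "(2 - fps_X :: real fps) \<noteq> 0"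
  proof
    assume "(2 - fps_X :: real fps) = 0"
    then have "fps_nth (2 - fps_X :: real fps) 0 = 0" by simp
    then show False by (simp add: numeral_fps_const)
  qed
  ultimately show "?F = 2 * fps_X / (2 - fps_X)"
    by (metis nonzero_mult_div_cancel_right)
qed

end
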